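(* Let $(\mathbb{X},\oplus,\otimes,\mathbb{0},\mathbb{1})$ be a linearly ordered radicable idempotent semifield. Given matrices $\mathbf{A},\mathbf{B}\in\mathbb{X}^{n\times n}$ and vectors $\mathbf{g},\mathbf{h}\in\mathbb{X}^{n}$, consider the bi-objective problem of finding regular vectors $\mathbf{x}\in\mathbb{X}^{n}$ that achieve $$\min_{\mathbf{x}}\ (\mathbf{x}^{-}\mathbf{A}\mathbf{x},\ \mathbf{x}^{-}\mathbf{B}\mathbf{x})\qquad\text{s.t.}\quad \mathbf{g}\leq\mathbf{x}\leq\mathbf{h}. \tag{P}$$ Let $\mathbf{A}$ and $\mathbf{B}$ be nonzero matrices, $\mathbf{g}$ be a vector and $\mathbf{h}$ a regular vector such that $\mathbf{g}\leq\mathbf{h}$. Denote the spectral radii of $\mathbf{A}$ and $\mathbf{B}$ by $$\lambda=\bigoplus_{k=1}^{n}\mathrm{tr}^{1/k}(\mathbf{A}^{k}),\qquad \mu=\bigoplus_{k=1}^{n}\mathrm{tr}^{1/k}(\mathbf{B}^{k}),$$ and introduce the scalars $$\gamma=\bigoplus_{k=1}^{n-1}(\mathbf{h}^{-}\mathbf{A}^{k}\mathbf{g})^{1/k},\qquad \delta=\bigoplus_{k=1}^{n-1}(\mathbf{h}^{-}\mathbf{B}^{k}\mathbf{g})^{1/k}.$$ For all $s,t>\mathbb{0}$, define the functions $$G(s)=\bigoplus_{k=1}^{n-1}\bigoplus_{m=1}^{n-k}s^{-m/k}\,\mathrm{tr}^{1/k}(\mathbf{F}_{km})\oplus\bigoplus_{k=1}^{n-2}\bigoplus_{m=1}^{n-k-1}s^{-m/k}(\mathbf{h}^{-}\mathbf{F}_{km}\mathbf{g})^{1/k},$$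 $$H(t)=\bigoplus_{k=1}^{n-1}\bigoplus_{m=1}^{n-k}t^{-k/m}\,\mathrm{tr}^{1/m}(\mathbf{F}_{km})\oplus\bigoplus_{k=1}^{n-2}\bigoplus_{m=1}^{n-k-1}t^{-k/m}(\mathbf{h}^{-}\mathbf{F}_{km}\mathbf{g})^{1/m},$$ where, for $m=1,\ldots,n-k$ and $k=1,\ldots,n-1$, $$\mathbf{F}_{km}=\bigoplus_{\substack{i_{0}+i_{1}+\cdots+i_{k}=m\\ i_{0},i_{1},\ldots,i_{k}\geq0}}\mathbf{A}^{i_{0}}(\mathbf{B}\mathbf{A}^{i_{1}}\cdots\mathbf{B}\mathbf{A}^{i_{k}}).$$ Then the following statements hold. 1. If $H(\mu\oplus\delta)\leq\lambda\oplus\gamma$, then the Pareto front of problem (P) reduces to a single point $(\alpha,\beta)$ with the coordinates $\alpha=\lambda\oplus\gamma$, $\beta=\mu\oplus\delta$. 2. If $H(\mu\oplus\delta)>\lambda\oplus\gamma$, then the Pareto front forms a segment of points $(\alpha,\beta)$ defined by the conditions $$\lambda\oplus\gamma\leq\alpha\leq H(\mu\oplus\delta),\qquad \beta=G(\alpha).$$ 3. All Pareto-optimal solutions of problem (P) are given in parametric form by $$\mathbf{x}=(\alpha^{-1}\mathbf{A}\oplus\beta^{-1}\mathbf{B})^{\ast}\mathbf{u},$$ where $(\alpha,\beta)$ ranges over the Pareto front described in 1 and 2, and $\mathbf{u}$ is a vector of parameters that satisfies the condition $$\mathbf{g}\leq\mathbf{u}\leq(\mathbf{h}^{-}(\alp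ha^{-1}\mathbf{A}\oplus\beta^{-1}\mathbf{B})^{\ast})^{-}.$$
   Context: Idempotent semifield: a set $\mathbb{X}$ with associative and commutative operations $\oplus$ (addition, neutral element $\mathbb{0}$) and $\otimes$ (multiplication, neutral element $\mathbb{1}$; the sign $\otimes$ is omitted), where multiplication distributes over addition, addition is idempotent ($x\oplus x=x$), and every $x\neq\mathbb{0}$ has a multiplicative inverse $x^{-1}$. It is radicable: each $x$ has a $p$th root for every integer $p>0$, so rational powers are defined (with $\mathbb{0}^{p}=\mathbb{0}$ for $p>0$, and $x^{0}=\mathbb{1}$ for nonzero $x$). The order is $x\leq y$ iff $x\oplus y=y$, and it is assumed to be total. (Example: the max-algebra $(\mathbb{R}_{+},\max,\times,0,1)$.) Matrices and vectors: operations follow the usual entrywise formulas with $\oplus,\otimes$ in place of ordinary addition and multiplication; inequalities are componentwise. A zero matrix (vector) has all entries $\mathbb{0}$. A vector is regular if it has no zero components. $\mathbf{I}$ is the identity matrix ($\mathbb{1}$ on the diagonal, $\mathbb{0}$ elsewhere); $\mathbf{A}^{0}=\mathbf{I}$, $\mathbf{A}^{p}=\mathbf{A}\mathbf{A}^{p-1}$. The trace is $\mathrm{tr}\,\mathbf{A}=a_{11}\oplus\cdots\oplus a_{nn}$, and $\mathrm{tr}^{1/k}(\mathbf{M})$ means $(\mathrm{tr}\,\mathbf{M})^{1/k}$. The Kleene star of an $n\times n$ matrix $\mathbf{M}$ is $\mathbf{M}^{\ast}=\mathbf{I}\oplus\mathbf{M}\oplus\cdots\oplus\mathbf{M}^{n-1}$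 (used when $\mathrm{tr}\,\mathbf{M}\oplus\cdots\oplus\mathrm{tr}\,\mathbf{M}^{n}\leq\mathbb{1}$). For a nonzero column vector $\mathbf{x}=(x_{j})$, the conjugate $\mathbf{x}^{-}=(x_{j}^{-})$ is the row vector with $x_{j}^{-}=x_{j}^{-1}$ if $x_{j}\neq\mathbb{0}$ and $x_{j}^{-}=\mathbb{0}$ otherwise; the conjugate of a row vector is defined likewise as a column vector. Empty sums equal $\mathbb{0}$. Pareto optimality: a feasible (regular) vector is a Pareto-optimal solution of the bi-objective minimization problem if it cannot be improved (replaced by a feasible vector with smaller value) in one objective without getting worse in the other. The Pareto front is the image of the set of Pareto-optimal solutions in the objective space, i.e. the set of points $(\alpha,\beta)=(\mathbf{x}^{-}\mathbf{A}\mathbf{x},\mathbf{x}^{-}\mathbf{B}\mathbf{x})$ over Pareto-optimal $\mathbf{x}$.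
   Formalization: Items 1 and 2 assume μ⊕δ > 0 (else H(μ⊕δ) is undefined); item 1 also assumes λ⊕γ > 0 (else false, as α > 0 on the front); in item 2 the segment is restricted to α > 0, the domain of G; in item 3 the vectors x are required to be regular. *)

theory Defs
  imports "HOL-Analysis.Determinants"
begin

section \<open>Linearly ordered radicable idempotent semifields\<close>

text \<open>The semifield operations are written \<open>+\<close>, \<open>*\<close>, \<open>0\<close>, \<open>1\<close>, so that finite sums and the
  library's matrix operations can be used directly. The only choices made here are the totalisation
  \<open>inverse 0 = 0\<close> and the meaning of the derived operation \<open>/\<close>. That zero is absorbing (part of
  \<^class>\<open>comm_semiring_1\<close>) follows from the other axioms, and \<open>0 \<noteq> 1\<close> holds as soon as there is a
  nonzero element.\<close>

class idempotent_semifield = comm_semiring_1 + inverse +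
  assumes add_idem: "a + a = a"
    and left_inverse_semifield: "a \<noteq> 0 \<Longrightarrow> inverse a * a = 1"
    and inverse_zero_semifield: "inverse 0 = 0"
    and divide_inverse_semifield: "a / b = a * inverse b"

class linordered_radicable_idempotent_semifield = idempotent_semifield + linorder +
  assumes less_eq_iff_add: "a \<le> b \<longleftrightarrow> a + b = b"
    and radicable: "0 < p \<Longrightarrow> \<exists>b. b ^ p = a"

context linordered_radicable_idempotent_semifield
begin

lemma semifield_mult_mono_strict:
  assumes "a < b" "c \<noteq> 0"
  shows "c * a < c * b"
proof -
  have "a + b = b" using less_imp_le[OF assms(1)] less_eq_iff_add by blast
  hence "c * a + c * b = c * b" by (metis distrib_left)
  hence "c * a \<le> c * b" using less_eq_iff_add by simp
  moreover have "c * a \<noteq> c * b"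
    using assms by (metis left_inverse_semifield mult.assoc mult_1_left less_irrefl)
  ultimately show ?thesis by simp
qed

lemma semifield_zero_le: "0 \<le> a"
  by (simp add: less_eq_iff_add)

lemma semifield_power_strict_mono:
  assumes "a < b"
  shows "a ^ Suc p < b ^ Suc p"
proof (induction p)
  case 0
  show ?case using assms by simp
next
  case (Suc p)
  have b: "b \<noteq> 0" using assms semifield_zero_le leD by blast
  have "a + b = b" using less_imp_le[OF assms] less_eq_iff_add by blast
  hence "a ^ Suc p * a + a ^ Suc p * b = a ^ Suc p * b" by (metis distrib_left)
  hence "a ^ Suc p * a \<le> a ^ Suc p * b" using less_eq_iff_add by simp
  also have "a ^ Suc p * b < b ^ Suc p * b"
    using semifield_mult_mono_strict[OF Suc b] by (simp only: mult.commute)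
  finally show ?case by (simp only: power_Suc mult.commute mult.left_commute)
qed

lemma ex1_root:
  assumes "0 < p"
  shows "\<exists>!b. b ^ p = a"
proof -
  obtain q where p: "p = Suc q" using assms gr0_implies_Suc by blast
  have "b = c" if "b ^ p = a" "c ^ p = a" for b c
    using that semifield_power_strict_mono[of b c q] semifield_power_strict_mono[of c b q]
    unfolding p by (metis less_irrefl linorder_cases)
  thus ?thesis using radicable[OF assms] by blast
qed

end

text \<open>Rational powers: \<open>x\<close> to the power \<open>p / q\<close> (in lowest terms, \<open>q > 0\<close>) is the \<open>q\<close>th root of
  \<open>x powi p\<close>, which is unique by the preceding lemma.\<close>

definition rat_pow :: "'a::linordered_radicable_idempotent_semifield \<Rightarrow> rat \<Rightarrow> 'a"
    (infixr \<open>powq\<close> 80) where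
  "x powq r = (THE y. y ^ nat (snd (quotient_of r)) = x powi fst (quotient_of r))"


section \<open>Vectors and matrices\<close>

text \<open>Row and column vectors are both represented by \<open>'a ^ 'n\<close>. The order on vectors is the
  library's componentwise order. The class \<open>power\<close> is not used for matrices because the library
  multiplication \<open>*\<close> on \<open>'a ^ 'n ^ 'n\<close> is entrywise.\<close>

definition regular :: "'a::zero ^ 'n \<Rightarrow> bool" where
  "regular x \<longleftrightarrow> (\<forall>i. x $ i \<noteq> 0)"

text \<open>Zero components are sent to zero since \<open>inverse 0 = 0\<close>.\<close>

definition conj_vec :: "'a::idempotent_semifield ^ 'n \<Rightarrow> 'a ^ 'n" where
  "conj_vec x = (\<chi> j. inverse (x $ j))"

definition smult_mat :: "'a::semiring_1 \<Rightarrow> 'a ^ 'n ^ 'm \<Rightarrow> 'a ^ 'n ^ 'm" where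
  "smult_mat c M = (\<chi> i j. c * M $ i $ j)"

primrec mat_pow :: "'a::semiring_1 ^ 'n ^ 'n \<Rightarrow> nat \<Rightarrow> 'a ^ 'n ^ 'n" where
  "mat_pow M 0 = mat 1"
| "mat_pow M (Suc p) = M ** mat_pow M p"

definition kleene_star :: "'a::semiring_1 ^ 'n ^ 'n \<Rightarrow> 'a ^ 'n ^ 'n" where
  "kleene_star M = (\<Sum>p<CARD('n). mat_pow M p)"

text \<open>\<open>row_mat_col u M v\<close> is the scalar \<open>u M v\<close> for a row vector \<open>u\<close> and a column vector \<open>v\<close>.\<close>

definition row_mat_col :: "'a::semiring_1 ^ 'm \<Rightarrow> 'a ^ 'n ^ 'm \<Rightarrow> 'a ^ 'n \<Rightarrow> 'a" where
  "row_mat_col u M v = scalar_product u (M *v v)"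

definition spectral_radius ::
    "'a::linordered_radicable_idempotent_semifield ^ 'n ^ 'n \<Rightarrow> 'a" where
  "spectral_radius M = (\<Sum>k = 1..CARD('n). trace (mat_pow M k) powq (1 / of_nat k))"

definition bound_scalar ::
    "'a::linordered_radicable_idempotent_semifield ^ 'n ^ 'n \<Rightarrow> 'a ^ 'n \<Rightarrow> 'a ^ 'n \<Rightarrow> 'a" where
  "bound_scalar M g h =
     (\<Sum>k = 1..CARD('n) - 1. row_mat_col (conj_vec h) (mat_pow M k) g powq (1 / of_nat k))"

text \<open>\<open>word_mat A B [i\<^sub>0, i\<^sub>1, \<dots>, i\<^sub>k]\<close> is the product \<open>A\<^bsup>i\<^sub>0\<^esup> (B A\<^bsup>i\<^sub>1\<^esup> \<cdots> B A\<^bsup>i\<^sub>k\<^esup>)\<close>, and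
  \<open>mixed_mat A B k m\<close> sums these over all exponent tuples of length \<open>k + 1\<close> and total \<open>m\<close>.\<close>

definition word_mat ::
    "'a::semiring_1 ^ 'n ^ 'n \<Rightarrow> 'a ^ 'n ^ 'n \<Rightarrow> nat list \<Rightarrow> 'a ^ 'n ^ 'n" where
  "word_mat A B is =
     mat_pow A (hd is) ** foldr (\<lambda>i M. (B ** mat_pow A i) ** M) (tl is) (mat 1)"

definition exponent_tuples :: "nat \<Rightarrow> nat \<Rightarrow> nat list set" where
  "exponent_tuples k m = {is. length is = k + 1 \<and> sum_list is = m}"

lemma finite_exponent_tuples: "finite (exponent_tuples k m)"
proof (rule finite_subset)
  show "exponent_tuples k m \<subseteq> {is. set is \<subseteq> {..m} \<and> length is = k + 1}"
    unfolding exponent_tuples_def using member_le_sum_list by fastforce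
  show "finite {is. set is \<subseteq> {..m} \<and> length is = k + 1}"
    by (rule finite_lists_length_eq) simp
qed

definition mixed_mat ::
    "'a::semiring_1 ^ 'n ^ 'n \<Rightarrow> 'a ^ 'n ^ 'n \<Rightarrow> nat \<Rightarrow> nat \<Rightarrow> 'a ^ 'n ^ 'n" where
  "mixed_mat A B k m = (\<Sum>is \<in> exponent_tuples k m. word_mat A B is)"

text \<open>The functions \<open>G\<close> and \<open>H\<close> are meaningful for nonzero scalar arguments only.\<close>

definition G_fun :: "'a::linordered_radicable_idempotent_semifield ^ 'n ^ 'n \<Rightarrow> 'a ^ 'n ^ 'n \<Rightarrow>
    'a ^ 'n \<Rightarrow> 'a ^ 'n \<Rightarrow> 'a \<Rightarrow> 'a" where
  "G_fun A B g h s =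
     (\<Sum>k = 1..CARD('n) - 1. \<Sum>m = 1..CARD('n) - k.
        s powq (- of_nat m / of_nat k) * trace (mixed_mat A B k m) powq (1 / of_nat k)) +
     (\<Sum>k = 1..CARD('n) - 2. \<Sum>m = 1..CARD('n) - k - 1.
        s powq (- of_nat m / of_nat k) *
          row_mat_col (conj_vec h) (mixed_mat A B k m) g powq (1 / of_nat k))"

definition H_fun :: "'a::linordered_radicable_idempotent_semifield ^ 'n ^ 'n \<Rightarrow> 'a ^ 'n ^ 'n \<Rightarrow>
    'a ^ 'n \<Rightarrow> 'a ^ 'n \<Rightarrow> 'a \<Rightarrow> 'a" where
  "H_fun A B g h t =
     (\<Sum>k = 1..CARD('n) - 1. \<Sum>m = 1..CARD('n) - k.
        t powq (- of_nat k / of_nat m) * trace (mixed_mat A B k m) powq (1 / of_nat m)) +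
     (\<Sum>k = 1..CARD('n) - 2. \<Sum>m = 1..CARD('n) - k - 1.
        t powq (- of_nat k / of_nat m) *
          row_mat_col (conj_vec h) (mixed_mat A B k m) g powq (1 / of_nat m))"


section \<open>Bi-objective minimization\<close>

definition pareto_optimal ::
    "'b set \<Rightarrow> ('b \<Rightarrow> 'a::linorder) \<Rightarrow> ('b \<Rightarrow> 'a) \<Rightarrow> 'b \<Rightarrow> bool" where
  "pareto_optimal S f\<^sub>1 f\<^sub>2 x \<longleftrightarrow> x \<in> S \<and>
     \<not> (\<exists>y\<in>S. f\<^sub>1 y < f\<^sub>1 x \<and> f\<^sub>2 y \<le> f\<^sub>2 x \<or> f\<^sub>1 y \<le> f\<^sub>1 x \<and> f\<^sub>2 y < f\<^sub>2 x)"

definition feasible :: "'a::linordered_radicable_idempotent_semifield ^ 'n \<Rightarrow> 'a ^ 'n \<Rightarrow>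
    ('a ^ 'n) set" where
  "feasible g h = {x. regular x \<and> g \<le> x \<and> x \<le> h}"

definition objective :: "'a::linordered_radicable_idempotent_semifield ^ 'n ^ 'n \<Rightarrow> 'a ^ 'n \<Rightarrow> 'a"
  where "objective M x = row_mat_col (conj_vec x) M x"

definition pareto_solutions :: "'a::linordered_radicable_idempotent_semifield ^ 'n ^ 'n \<Rightarrow>
    'a ^ 'n ^ 'n \<Rightarrow> 'a ^ 'n \<Rightarrow> 'a ^ 'n \<Rightarrow> ('a ^ 'n) set" where
  "pareto_solutions A B g h = {x. pareto_optimal (feasible g h) (objective A) (objective B) x}"

definition pareto_front :: "'a::linordered_radicable_idempotent_semifield ^ 'n ^ 'n \<Rightarrow>
    'a ^ 'n ^ 'n \<Rightarrow> 'a ^ 'n \<Rightarrow> 'a ^ 'n \<Rightarrow> ('a \<times> 'a) set" where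
  "pareto_front A B g h = (\<lambda>x. (objective A x, objective B x)) ` pareto_solutions A B g h"

end

theory Submission
  imports Defs
begin

text \<open>For \<open>\<alpha>, \<beta> > 0\<close>, a regular \<open>x\<close> has objective values at most \<open>(\<alpha>, \<beta>)\<close> iff \<open>C x \<le> x\<close> for
  \<open>C = \<alpha>\<^sup>-\<^sup>1 A \<oplus> \<beta>\<^sup>-\<^sup>1 B\<close>. Such an \<open>x\<close> between \<open>g\<close> and \<open>h\<close> exists iff all \<open>tr C\<^sup>k \<le> 1\<close> and
  \<open>h\<^sup>- C\<^sup>* g \<le> 1\<close>, and is then of the form \<open>C\<^sup>* u\<close>. Expanding the powers of \<open>C\<close> in terms of the
  matrices \<open>F\<^bsub>km\<^esub>\<close> turns the existence condition into \<open>\<lambda> \<oplus> \<gamma> \<le> \<alpha>\<close> (terms with \<open>k = 0\<close>),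
  \<open>\<mu> \<oplus> \<delta> \<le> \<beta>\<close> (terms with \<open>m = 0\<close>) and \<open>G \<alpha> \<le> \<beta>\<close> (all others). The Pareto front consists of
  the minimal points of this region; they are found from the equivalences
  \<open>G \<alpha> \<le> \<beta> \<longleftrightarrow> H \<beta> \<le> \<alpha>\<close> and \<open>G \<alpha> < \<beta> \<longleftrightarrow> H \<beta> < \<alpha>\<close>.\<close>

section \<open>Order and roots in the semifield\<close>

text \<open>If \<open>a \<le> b\<close>, then \<open>b\<close> itself serves as the summand
  \<open>c\<close>; conversely, idempotency absorbs \<open>a\<close> into \<open>a + c\<close>. The
  instance provides \<open>0\<close> as least element and monotone finite sums.\<close>

instance linordered_radicable_idempotent_semifield \<subseteq> canonically_ordered_monoid_add
proof
  fix a b :: 'a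
  show "a \<le> b \<longleftrightarrow> (\<exists>c. b = a + c)"
    by (metis add.assoc add_idem less_eq_iff_add)
qed

instance linordered_radicable_idempotent_semifield \<subseteq> ordered_comm_semiring
proof
  fix a b c :: 'a
  assume "a \<le> b"
  then show "c * a \<le> c * b"
    by (metis distrib_left less_eq_iff_add)
qed

lemma semifield_add_eq_max:
  fixes a b :: "'a::linordered_radicable_idempotent_semifield"
  shows "a + b = max a b"
  by (cases a b rule: linorder_le_cases)
    (simp_all add: less_eq_iff_add max_def add.commute[of b a])

lemma semifield_add_le_iff:
  fixes a b c :: "'a::linordered_radicable_idempotent_semifield"
  shows "a + b \<le> c \<longleftrightarrow> a \<le> c \<and> b \<le> c"
  by (simp add: semifield_add_eq_max)

lemma semifield_add_less_iff:
  fixes a b c :: "'a::linordered_radicable_idempotent_semifield"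
  shows "a + b < c \<longleftrightarrow> a < c \<and> b < c"
  by (simp add: semifield_add_eq_max)

lemma semifield_sum_le_iff:
  fixes f :: "'b \<Rightarrow> 'a::linordered_radicable_idempotent_semifield"
  assumes "finite S"
  shows "sum f S \<le> c \<longleftrightarrow> (\<forall>x\<in>S. f x \<le> c)"
  using assms by induction (auto simp: semifield_add_le_iff)

text \<open>The bound is taken positive because the empty sum is \<open>0\<close>.\<close>

lemma semifield_sum_less_iff:
  fixes f :: "'b \<Rightarrow> 'a::linordered_radicable_idempotent_semifield"
  assumes "finite S" "0 < c"
  shows "sum f S < c \<longleftrightarrow> (\<forall>x\<in>S. f x < c)"
  using assms by induction (auto simp: semifield_add_less_iff)

lemma semifield_mult_le_cancel_left:
  fixes a b c :: "'a::linordered_radicable_idempotent_semifield"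
  assumes "0 < c"
  shows "c * a \<le> c * b \<longleftrightarrow> a \<le> b"
  using assms semifield_mult_mono_strict[of b a c] mult_left_mono[of a b c]
  by (auto simp: not_le[symmetric])

lemma semifield_mult_inverse_cancel:
  fixes a c :: "'a::linordered_radicable_idempotent_semifield"
  assumes "0 < c"
  shows "c * (inverse c * a) = a"
proof -
  have "inverse c * c = 1"
    using assms by (simp add: left_inverse_semifield)
  then show ?thesis
    by (simp add: mult.assoc[symmetric] mult.commute[of c])
qed

lemma semifield_inverse_mult_le_iff:
  fixes a b c :: "'a::linordered_radicable_idempotent_semifield"
  assumes "0 < c"
  shows "inverse c * a \<le> b \<longleftrightarrow> a \<le> c * b"
  using semifield_mult_le_cancel_left[OF assms, of "inverse c * a" b]
  by (simp add: semifield_mult_inverse_cancel[OF assms])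

lemma semifield_mult_pos:
  fixes a b :: "'a::linordered_radicable_idempotent_semifield"
  assumes "0 < a" "0 < b"
  shows "0 < a * b"
  using semifield_mult_mono_strict[of 0 b a] assms by auto

lemma semifield_power_pos:
  fixes a :: "'a::linordered_radicable_idempotent_semifield"
  assumes "0 < a"
  shows "0 < a ^ k"
proof (induction k)
  case 0
  have "(1::'a) \<noteq> 0" by simp
  then show ?case by (simp only: power_0 not_gr_zero[symmetric] not_not)
qed (simp add: semifield_mult_pos assms)

lemma semifield_inverse_pos:
  fixes a :: "'a::linordered_radicable_idempotent_semifield"
  assumes "0 < a"
  shows "0 < inverse a"
  using assms left_inverse_semifield[of a] not_gr_zero[of "inverse a"] by fastforce

lemma semifield_inverse_power:
  fixes a :: "'a::linordered_radicable_idempotent_semifield"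
  assumes "0 < a"
  shows "inverse (a ^ k) = inverse a ^ k"
proof -
  have "inverse a ^ k * a ^ k = 1"
    using assms by (simp add: power_mult_distrib[symmetric] left_inverse_semifield)
  then show ?thesis
    using semifield_mult_inverse_cancel[OF semifield_power_pos[OF assms], of k "inverse a ^ k"]
    by (simp add: mult.left_commute[of "a ^ k"] mult.commute[of "a ^ k"] mult.assoc)
qed

lemma semifield_power_less_iff:
  fixes a b :: "'a::linordered_radicable_idempotent_semifield"
  assumes "0 < k"
  shows "a ^ k < b ^ k \<longleftrightarrow> a < b"
  using assms semifield_power_strict_mono[of a b "k - 1"] semifield_power_strict_mono[of b a "k - 1"]
  by (cases a b rule: linorder_cases) auto

lemma semifield_power_le_iff:
  fixes a b :: "'a::linordered_radicable_idempotent_semifield"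
  assumes "0 < k"
  shows "a ^ k \<le> b ^ k \<longleftrightarrow> a \<le> b"
  using semifield_power_less_iff[OF assms] by (metis not_le)

lemma semifield_power_eq_iff:
  fixes a b :: "'a::linordered_radicable_idempotent_semifield"
  assumes "0 < k"
  shows "a ^ k = b ^ k \<longleftrightarrow> a = b"
  using semifield_power_le_iff[OF assms] by (metis order.eq_iff)

section \<open>Roots and rational powers\<close>

lemma rat_pow_quotient_of:
  fixes x :: "'a::linordered_radicable_idempotent_semifield"
  assumes "quotient_of r = (p, q)"
  shows "(x powq r) ^ nat q = x powi p"
proof -
  have "0 < nat q"
    using quotient_of_denom_pos[OF assms] by simp
  from theI'[OF ex1_root[OF this, of "x powi p"]] show ?thesis
    by (simp add: rat_pow_def assms)
qed

lemma rat_pow_root: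
  fixes x :: "'a::linordered_radicable_idempotent_semifield"
  assumes "0 < k"
  shows "(x powq (1 / of_nat k)) ^ k = x"
proof -
  have "quotient_of (1 / of_nat k :: rat) = (1, int k)"
    using assms quotient_of_Fract[of 1 "int k"]
    by (simp add: Fract_of_int_quotient normalize_def)
  from rat_pow_quotient_of[OF this, of x] show ?thesis
    by (simp add: power_int_def)
qed

text \<open>The fraction \<open>- m / k\<close> need not be in lowest terms. If \<open>p / q\<close>
  is its reduced form, then \<open>- m * q = p * k\<close>, so both sides agree after a further
  \<open>q\<close>th power, and powers with positive exponent are injective.\<close>

lemma rat_pow_neg_power:
  fixes x :: "'a::linordered_radicable_idempotent_semifield"
  assumes "0 < k"
  shows "(x powq (- of_nat m / of_nat k)) ^ k = inverse x ^ m"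
proof -
  obtain p q where pq: "quotient_of (- of_nat m / of_nat k :: rat) = (p, q)"
    by fastforce
  have q: "0 < q"
    using quotient_of_denom_pos[OF pq] .
  have "- of_nat m / of_nat k = (of_int p / of_int q :: rat)"
    using quotient_of_div[OF pq] .
  then have "(- of_nat m * of_int q :: rat) = of_int p * of_nat k"
    using q assms by (simp add: field_simps)
  then have "of_int (- int m * q) = (of_int (p * int k) :: rat)"
    by simp
  then have eq: "- int m * q = p * int k"
    by (simp only: of_int_eq_iff)
  then have p: "p \<le> 0"
    using q assms by (smt (verit) mult_pos_pos of_nat_0_less_iff of_nat_0_le_iff mult_nonneg_nonneg
        minus_mult_left)
  have eq': "m * nat q = nat (- p) * k"
  proof -
    have "int (m * nat q) = int (nat (- p) * k)"
      using eq q p by (simp add: algebra_simps)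
    then show ?thesis
      by (simp only: of_nat_eq_iff)
  qed
  have powi: "x powi p = inverse x ^ nat (- p)"
    using p by (cases "p = 0") (auto simp: power_int_def)
  let ?y = "x powq (- of_nat m / of_nat k)"
  have "(?y ^ k) ^ nat q = (?y ^ nat q) ^ k"
    by (simp add: power_mult[symmetric] mult.commute)
  also have "\<dots> = (inverse x ^ m) ^ nat q"
    by (simp only: rat_pow_quotient_of[OF pq] powi power_mult[symmetric] eq')
  finally show ?thesis
    using q by (simp add: semifield_power_eq_iff)
qed

lemma root_term_power:
  fixes c s :: "'a::linordered_radicable_idempotent_semifield"
  assumes "0 < k" "0 < s"
  shows "(s powq (- of_nat m / of_nat k) * c powq (1 / of_nat k)) ^ k = inverse (s ^ m) * c"
  by (simp only: power_mult_distrib rat_pow_neg_power[OF assms(1)] rat_pow_root[OF assms(1)]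
      semifield_inverse_power[OF assms(2)])

lemma root_le_iff:
  fixes b c :: "'a::linordered_radicable_idempotent_semifield"
  assumes "0 < k"
  shows "c powq (1 / of_nat k) \<le> b \<longleftrightarrow> c \<le> b ^ k"
  using semifield_power_le_iff[OF assms, of "c powq (1 / of_nat k)" b] assms
  by (simp add: rat_pow_root)

text \<open>Taking \<open>k\<close>th powers removes the fractional exponents, and the inverse power
  of \<open>s\<close> moves across by residuation. What remains is a bound by a monomial in
  \<open>s\<close> and \<open>b\<close>; this common form links \<open>G_fun\<close> and
  \<open>H_fun\<close>.\<close>

lemma root_term_le_iff:
  fixes b c s :: "'a::linordered_radicable_idempotent_semifield"
  assumes "0 < k" "0 < s"
  shows "s powq (- of_nat m / of_nat k) * c powq (1 / of_nat k) \<le> b \<longleftrightarrow> c \<le> s ^ m * b ^ k"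
  using semifield_power_le_iff[OF assms(1)] root_term_power[OF assms]
    semifield_inverse_mult_le_iff[OF semifield_power_pos[OF assms(2)]]
  by metis

lemma root_term_less_iff:
  fixes b c s :: "'a::linordered_radicable_idempotent_semifield"
  assumes "0 < k" "0 < s"
  shows "s powq (- of_nat m / of_nat k) * c powq (1 / of_nat k) < b \<longleftrightarrow> c < s ^ m * b ^ k"
proof -
  have "inverse (s ^ m) * c < b ^ k \<longleftrightarrow> c < s ^ m * b ^ k"
    using semifield_mult_le_cancel_left[OF semifield_power_pos[OF assms(2)],
        of m "b ^ k" "inverse (s ^ m) * c"]
    unfolding semifield_mult_inverse_cancel[OF semifield_power_pos[OF assms(2)]]
    by (simp only: not_le[symmetric])
  then show ?thesis
    using semifield_power_less_iff[OF assms(1)] root_term_power[OF assms] by metis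
qed


section \<open>Matrices, residuation and the Kleene star\<close>

lemma regular_iff_pos:
  fixes h :: "'a::linordered_radicable_idempotent_semifield ^ 'n"
  shows "regular h \<longleftrightarrow> (\<forall>i. 0 < h $ i)"
  by (simp only: regular_def zero_less_iff_neq_zero)

lemmas regular_pos = regular_iff_pos[THEN iffD1, rule_format]

text \<open>Sums being maxima, the bound splits over the components, and each
  \<open>inverse (h $ i)\<close> moves to the other side because \<open>h $ i\<close> is
  positive.\<close>

lemma row_mat_col_conj_le_iff:
  fixes h :: "'a::linordered_radicable_idempotent_semifield ^ 'n"
  assumes "regular h"
  shows "row_mat_col (conj_vec h) M v \<le> c \<longleftrightarrow> (\<forall>i. (M *v v) $ i \<le> h $ i * c)"
  by (simp add: row_mat_col_def scalar_product_def conj_vec_def semifield_sum_le_iff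
      semifield_inverse_mult_le_iff[OF regular_pos[OF assms]])

lemma matrix_vector_le_iff:
  fixes M :: "'a::linordered_radicable_idempotent_semifield ^ 'n ^ 'm"
  shows "(M *v v) $ i \<le> c \<longleftrightarrow> (\<forall>j. M $ i $ j * v $ j \<le> c)"
  by (simp add: matrix_vector_mult_def semifield_sum_le_iff)

lemma matrix_vector_mono:
  fixes M :: "'a::linordered_radicable_idempotent_semifield ^ 'n ^ 'm"
  assumes "x \<le> y"
  shows "M *v x \<le> M *v y"
  using assms by (auto simp: less_eq_vec_def matrix_vector_mult_def intro!: sum_mono mult_left_mono)

lemma matrix_vector_sum_right:
  fixes M :: "'a::semiring_1 ^ 'n ^ 'm"
  assumes "finite S"
  shows "M *v (\<Sum>p\<in>S. f p) = (\<Sum>p\<in>S. M *v f p)"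
  using assms by induction (simp_all add: matrix_vector_right_distrib)

lemma matrix_vector_sum_left:
  fixes f :: "'b \<Rightarrow> 'a::semiring_1 ^ 'n ^ 'm"
  assumes "finite S"
  shows "(\<Sum>p\<in>S. f p) *v v = (\<Sum>p\<in>S. f p *v v)"
  using assms by induction (simp_all add: matrix_vector_mult_add_rdistrib)

lemma matrix_mult_sum_right:
  fixes M :: "'a::semiring_1 ^ 'n ^ 'm"
  assumes "finite S"
  shows "M ** (\<Sum>p\<in>S. f p) = (\<Sum>p\<in>S. M ** f p)"
  using assms
proof induction
  case empty
  show ?case by (simp add: matrix_matrix_mult_def vec_eq_iff)
qed (simp add: matrix_add_ldistrib)

lemma vec_sum_le_iff:
  fixes f :: "'b \<Rightarrow> 'a::linordered_radicable_idempotent_semifield ^ 'n"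
  assumes "finite S"
  shows "sum f S \<le> y \<longleftrightarrow> (\<forall>p\<in>S. f p \<le> y)"
  using assms by (auto simp: less_eq_vec_def semifield_sum_le_iff)

section \<open>Matrix powers as maximal weights of walks\<close>

lemma mat_pow_add: "mat_pow M (p + q) = mat_pow M p ** mat_pow M q"
  by (induction p) (simp_all add: matrix_mul_assoc)

lemma mat_pow_sub_fixed:
  fixes M :: "'a::linordered_radicable_idempotent_semifield ^ 'n ^ 'n"
  assumes "M *v x \<le> x"
  shows "mat_pow M p *v x \<le> x"
proof (induction p)
  case (Suc p)
  have "mat_pow M (Suc p) *v x = M *v (mat_pow M p *v x)"
    by (simp add: matrix_vector_mul_assoc)
  also have "\<dots> \<le> M *v x"
    by (rule matrix_vector_mono[OF Suc])
  finally show ?case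
    using assms by (rule order_trans)
qed simp

lemma matrix_mult_entry_ge:
  fixes M :: "'a::linordered_radicable_idempotent_semifield ^ 'n ^ 'm"
  shows "M $ i $ l * N $ l $ j \<le> (M ** N) $ i $ j"
  unfolding matrix_matrix_mult_def by (auto intro!: member_le_sum)

text \<open>Read \<open>M $ i $ j\<close> as the weight of an arc. Then \<open>v\<close> is a walk
  of \<open>p\<close> arcs, and its weight is one of the terms whose sum, that is maximum, is the
  entry of the power.\<close>

lemma mat_pow_entry_ge_walk:
  fixes M :: "'a::linordered_radicable_idempotent_semifield ^ 'n ^ 'n"
  shows "(\<Prod>q<p. M $ v q $ v (Suc q)) \<le> mat_pow M p $ v 0 $ v p"
proof (induction p arbitrary: v)
  case 0
  show ?case by (simp add: mat_def)
next
  case (Suc p)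
  have "(\<Prod>q<Suc p. M $ v q $ v (Suc q)) =
      M $ v 0 $ v 1 * (\<Prod>q<p. M $ v (Suc q) $ v (Suc (Suc q)))"
    by (subst prod.lessThan_Suc_shift) simp
  also have "\<dots> \<le> M $ v 0 $ v 1 * mat_pow M p $ v 1 $ v (Suc p)"
    using Suc[of "\<lambda>q. v (Suc q)"] by (auto intro: mult_left_mono)
  also have "\<dots> \<le> mat_pow M (Suc p) $ v 0 $ v (Suc p)"
    using matrix_mult_entry_ge by (simp)
  finally show ?case .
qed

text \<open>Over a total order a nonempty finite sum equals one of its terms, so a nonzero entry is
  the weight of an optimal walk. The zero alternative covers the case without walks: off the
  diagonal for \<open>p = 0\<close>.\<close>

lemma mat_pow_entry_eq_walk:
  fixes M :: "'a::linordered_radicable_idempotent_semifield ^ 'n ^ 'n"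
  shows "mat_pow M p $ i $ j = 0 \<or>
    (\<exists>v. v 0 = i \<and> v p = j \<and> mat_pow M p $ i $ j = (\<Prod>q<p. M $ v q $ v (Suc q)))"
proof (induction p arbitrary: i)
  case 0
  show ?case by (auto simp: mat_def intro: exI[of _ "\<lambda>_. i"])
next
  case (Suc p)
  let ?f = "\<lambda>l. M $ i $ l * mat_pow M p $ l $ j"
  have eq: "mat_pow M (Suc p) $ i $ j = sum ?f UNIV"
    by (simp add: matrix_matrix_mult_def)
  \<comment> \<open>The second vertex \<open>l\<close> of the walk is chosen where the sum attains
    its maximum.\<close>
  have "Max (range ?f) \<in> range ?f"
    by (rule Max_in) auto
  then obtain l where "Max (range ?f) = ?f l"
    by blast
  then have l: "?f l' \<le> ?f l" for l'
    using Max_ge[of "range ?f" "?f l'"] by simp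
  have sum: "sum ?f UNIV = ?f l"
    by (intro antisym) (auto simp: semifield_sum_le_iff l intro!: member_le_sum)
  show ?case
  proof (cases "mat_pow M p $ l $ j = 0")
    case True
    then show ?thesis unfolding eq sum by simp
  next
    case False
    then obtain v where v: "v 0 = l" "v p = j" "mat_pow M p $ l $ j = (\<Prod>q<p. M $ v q $ v (Suc q))"
      using Suc[of l] by auto
    \<comment> \<open>This prepends the vertex \<open>i\<close> to the walk
      \<open>v\<close>.\<close>
    let ?w = "case_nat i v"
    have "(\<Prod>q<Suc p. M $ ?w q $ ?w (Suc q)) = ?f l"
      by (subst prod.lessThan_Suc_shift) (simp add: v)
    then show ?thesis
      by (intro disjI2 exI[of _ ?w]) (simp only: eq sum, simp add: v)
  qed
qed

text \<open>A walk of length \<open>n\<close> visits some vertex twice; the closed part in between has weight at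
  most \<open>1\<close> by the trace condition, and cutting it out leaves a shorter walk.\<close>

lemma mat_pow_card_entry_le:
  fixes M :: "'a::linordered_radicable_idempotent_semifield ^ 'n ^ 'n"
  assumes tr: "\<forall>k\<in>{1..CARD('n)}. trace (mat_pow M k) \<le> 1"
  shows "\<exists>q<CARD('n). mat_pow M CARD('n) $ i $ j \<le> mat_pow M q $ i $ j"
proof (cases "mat_pow M CARD('n) $ i $ j = 0")
  case True
  then show ?thesis by (auto intro: exI[of _ 0])
next
  case False
  let ?n = "CARD('n)"
  obtain v where v: "v 0 = i" "v ?n = j"
      "mat_pow M ?n $ i $ j = (\<Prod>q<?n. M $ v q $ v (Suc q))"
    using False mat_pow_entry_eq_walk[of M ?n i j] by auto
  have "\<not> inj_on v {..?n}"
  proof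
    assume "inj_on v {..?n}"
    then have "card {..?n} \<le> CARD('n)"
      by (rule card_inj_on_le) auto
    then show False by simp
  qed
  then obtain a b where ab: "a < b" "b \<le> ?n" "v a = v b"
    unfolding inj_on_def by (metis atMost_iff linorder_neqE_nat)
  let ?w = "\<lambda>q. M $ v q $ v (Suc q)"
  have split: "prod ?w {..<?n} = prod ?w {..<a} * prod ?w {a..<b} * prod ?w {b..<?n}"
    using ab by (simp add: lessThan_atLeast0 prod.atLeastLessThan_concat)
  \<comment> \<open>A segment of the walk is again a walk.\<close>
  have shift: "prod ?w {c..<d} \<le> mat_pow M (d - c) $ v c $ v d" if "c \<le> d" for c d
  proof -
    have "prod ?w {c..<d} = (\<Prod>q<d - c. M $ v (c + q) $ v (c + Suc q))"
      using prod.shift_bounds_nat_ivl[of ?w 0 c "d - c"] that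
      by (simp add: lessThan_atLeast0 add.commute)
    then show ?thesis
      using mat_pow_entry_ge_walk[of M "\<lambda>q. v (c + q)" "d - c"] that by simp
  qed
  have "mat_pow M (b - a) $ v a $ v a \<le> trace (mat_pow M (b - a))"
    unfolding trace_def by (rule member_le_sum) auto
  also have "\<dots> \<le> 1"
  proof -
    have "b - a \<in> {1..?n}"
      unfolding atLeastAtMost_iff using ab by linarith
    then show ?thesis using tr by blast
  qed
  finally have cycle: "prod ?w {a..<b} \<le> 1"
    using shift[of a b] ab by simp
  have "mat_pow M ?n $ i $ j \<le> prod ?w {..<a} * 1 * prod ?w {b..<?n}"
    unfolding v(3) split by (intro mult_right_mono mult_left_mono cycle) auto
  also have "\<dots> \<le> mat_pow M a $ i $ v a * mat_pow M (?n - b) $ v b $ j"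
    using shift[of 0 a] shift[of b ?n] ab v
    by (auto simp: lessThan_atLeast0 intro!: mult_mono)
  also have "\<dots> \<le> mat_pow M (a + (?n - b)) $ i $ j"
    unfolding mat_pow_add using matrix_mult_entry_ge ab by metis
  finally show ?thesis
    using ab by (intro exI[of _ "a + (?n - b)"]) auto
qed

section \<open>The Kleene star and the inequality \<open>M *v x \<le> x\<close>\<close>

lemma kleene_star_vector_le_iff:
  fixes M :: "'a::linordered_radicable_idempotent_semifield ^ 'n ^ 'n"
  shows "kleene_star M *v u \<le> y \<longleftrightarrow> (\<forall>p<CARD('n). mat_pow M p *v u \<le> y)"
  by (simp add: kleene_star_def matrix_vector_sum_left vec_sum_le_iff Ball_def)

lemma mat_pow_le_kleene_star:
  fixes M :: "'a::linordered_radicable_idempotent_semifield ^ 'n ^ 'n"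
  assumes "p < CARD('n)"
  shows "mat_pow M p $ i $ j \<le> kleene_star M $ i $ j"
  unfolding kleene_star_def sum_component using assms
  by (intro member_le_sum) auto

lemma kleene_star_vector_ge:
  fixes M :: "'a::linordered_radicable_idempotent_semifield ^ 'n ^ 'n"
  shows "u \<le> kleene_star M *v u"
  using kleene_star_vector_le_iff[of M u "kleene_star M *v u"]
  by (metis order_refl zero_less_card_finite mat_pow.simps(1) matrix_vector_mul_lid)

text \<open>Multiplying the star by \<open>M\<close> raises every exponent by one. Only the power
  \<open>CARD('n)\<close> is new, and by cutting cycles its entries are bounded by entries of lower
  powers.\<close>

lemma kleene_star_vector_sub_fixed:
  fixes M :: "'a::linordered_radicable_idempotent_semifield ^ 'n ^ 'n"
  assumes "\<forall>k\<in>{1..CARD('n)}. trace (mat_pow M k) \<le> 1"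
  shows "M *v (kleene_star M *v u) \<le> kleene_star M *v u"
proof -
  have "mat_pow M (Suc p) *v u \<le> kleene_star M *v u" if "p < CARD('n)" for p
  proof -
    have "mat_pow M (Suc p) $ i $ j \<le> kleene_star M $ i $ j" for i j
    proof (cases "Suc p = CARD('n)")
      case True
      then show ?thesis
        using mat_pow_card_entry_le[OF assms, of i j] mat_pow_le_kleene_star order_trans
        unfolding True by blast
    next
      case False
      then show ?thesis
        using that by (intro mat_pow_le_kleene_star) auto
    qed
    then show ?thesis
      by (auto simp: less_eq_vec_def matrix_vector_mult_def simp del: mat_pow.simps
          intro!: sum_mono mult_right_mono)
  qed
  then show ?thesis
    by (simp add: kleene_star_def[of M] matrix_vector_sum_left matrix_vector_sum_right
        vec_sum_le_iff matrix_vector_mul_assoc)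
qed

text \<open>No power of \<open>M\<close> raises \<open>x\<close>, and the identity term of the star
  gives the other inequality. Every solution is thus its own parameter.\<close>

lemma kleene_star_vector_fixed:
  fixes M :: "'a::linordered_radicable_idempotent_semifield ^ 'n ^ 'n"
  assumes "M *v x \<le> x"
  shows "kleene_star M *v x = x"
  using assms kleene_star_vector_ge mat_pow_sub_fixed
  by (intro antisym) (auto simp: kleene_star_vector_le_iff)

text \<open>The identity term makes the diagonal of the star at least \<open>1\<close>. Positivity
  allows the conjugation in the parameter bound to be undone by residuation.\<close>

lemma conj_kleene_star_pos:
  fixes M :: "'a::linordered_radicable_idempotent_semifield ^ 'n ^ 'n"
  assumes "regular h"
  shows "0 < (conj_vec h v* kleene_star M) $ j"
proof -
  have "0 < inverse (h $ j) * 1"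
    by (simp add: semifield_inverse_pos regular_pos assms)
  also have "\<dots> \<le> inverse (h $ j) * kleene_star M $ j $ j"
    using mat_pow_le_kleene_star[of 0 M j j] by (intro mult_left_mono) (auto simp: mat_def)
  also have "\<dots> \<le> (conj_vec h v* kleene_star M) $ j"
    unfolding vector_matrix_mult_def conj_vec_def
    using member_le_sum[of j UNIV "\<lambda>i. inverse (h $ i) * kleene_star M $ i $ j"]
    by (simp add: mult.commute)
  finally show ?thesis .
qed

lemma le_conj_kleene_star_iff:
  fixes M :: "'a::linordered_radicable_idempotent_semifield ^ 'n ^ 'n"
  assumes "regular h"
  shows "u \<le> conj_vec (conj_vec h v* kleene_star M) \<longleftrightarrow> kleene_star M *v u \<le> h"
proof -
  let ?K = "kleene_star M"
  have "u $ j \<le> inverse ((conj_vec h v* ?K) $ j) \<longleftrightarrow> (\<forall>i. ?K $ i $ j * u $ j \<le> h $ i)" for j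
  proof -
    let ?r = "(conj_vec h v* ?K) $ j"
    have r: "?r = (\<Sum>i\<in>UNIV. inverse (h $ i) * ?K $ i $ j)"
      by (simp add: vector_matrix_mult_def conj_vec_def mult.commute)
    have "?r * inverse ?r = 1"
      using semifield_mult_inverse_cancel[OF conj_kleene_star_pos[OF assms], of M j 1] by simp
    then have "u $ j \<le> inverse ?r \<longleftrightarrow> ?r * u $ j \<le> 1"
      using semifield_mult_le_cancel_left[OF conj_kleene_star_pos[OF assms], of M j "u $ j" "inverse ?r"]
      by simp
    also have "\<dots> \<longleftrightarrow> (\<forall>i. ?K $ i $ j * u $ j \<le> h $ i)"
      by (simp add: r sum_distrib_right semifield_sum_le_iff mult.assoc
          semifield_inverse_mult_le_iff[OF regular_pos[OF assms]])
    finally show ?thesis .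
  qed
  then show ?thesis
    by (auto simp: less_eq_vec_def matrix_vector_le_iff conj_vec_def)
qed

text \<open>A solution \<open>x\<close> satisfies \<open>mat_pow M k *v x \<le> x\<close>:
  cancelling \<open>x $ i\<close> bounds the diagonal, and \<open>g \<le> x \<le> h\<close> gives
  the second condition. Conversely, the trace condition makes every
  \<open>kleene_star M *v u\<close> a solution, so one only has to be placed between
  \<open>g\<close> and \<open>h\<close>.\<close>

lemma sub_fixed_feasible_iff:
  fixes M :: "'a::linordered_radicable_idempotent_semifield ^ 'n ^ 'n"
  assumes "regular h"
  shows "(\<exists>x\<in>feasible g h. M *v x \<le> x) \<longleftrightarrow>
    (\<forall>k\<in>{1..CARD('n)}. trace (mat_pow M k) \<le> 1) \<and>
    (\<forall>k<CARD('n). row_mat_col (conj_vec h) (mat_pow M k) g \<le> 1)"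
proof -
  have row: "row_mat_col (conj_vec h) (mat_pow M k) g \<le> 1 \<longleftrightarrow> mat_pow M k *v g \<le> h" for k
    by (simp add: row_mat_col_conj_le_iff[OF assms] less_eq_vec_def)
  show ?thesis
    unfolding row
  proof (intro iffI conjI)
    assume "\<exists>x\<in>feasible g h. M *v x \<le> x"
    then obtain x where x: "regular x" "g \<le> x" "x \<le> h" "M *v x \<le> x"
      by (auto simp: feasible_def)
    have pow: "mat_pow M k *v x \<le> x" for k
      using mat_pow_sub_fixed[OF x(4)] .
    have "mat_pow M k $ i $ i \<le> 1" for k i
    proof -
      have "x $ i * mat_pow M k $ i $ i \<le> x $ i * 1"
        using pow[of k] unfolding less_eq_vec_def matrix_vector_le_iff by (simp add: mult.commute)
      then show ?thesis
        by (simp only: semifield_mult_le_cancel_left[OF regular_pos[OF x(1)]])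
    qed
    then show "\<forall>k\<in>{1..CARD('n)}. trace (mat_pow M k) \<le> 1"
      by (simp add: trace_def semifield_sum_le_iff)
    show "\<forall>k<CARD('n). mat_pow M k *v g \<le> h"
      using order_trans[OF order_trans[OF matrix_vector_mono[OF x(2)] pow] x(3)] by simp
  next
    let ?K = "kleene_star M"
    \<comment> \<open>This is the greatest vector with \<open>?K *v ?u \<le> h\<close>. All its
      components are positive, so the resulting solution is regular even when \<open>g\<close> has
      zeros.\<close>
    let ?u = "conj_vec (conj_vec h v* ?K)"
    assume *: "(\<forall>k\<in>{1..CARD('n)}. trace (mat_pow M k) \<le> 1) \<and>
      (\<forall>k<CARD('n). mat_pow M k *v g \<le> h)"
    have "g \<le> ?u"
      using * by (simp add: le_conj_kleene_star_iff[OF assms] kleene_star_vector_le_iff)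
    moreover have u: "?u \<le> ?K *v ?u"
      by (rule kleene_star_vector_ge)
    ultimately have "g \<le> ?K *v ?u"
      by (rule order_trans)
    moreover have "?K *v ?u \<le> h"
      using le_conj_kleene_star_iff[OF assms, of ?u M] by simp
    moreover have "0 < (?K *v ?u) $ i" for i
    proof -
      have "0 < ?u $ i"
        using conj_kleene_star_pos[OF assms] by (simp add: conj_vec_def semifield_inverse_pos)
      also have "\<dots> \<le> (?K *v ?u) $ i"
        using u unfolding less_eq_vec_def ..
      finally show ?thesis .
    qed
    ultimately have "?K *v ?u \<in> feasible g h"
      by (simp only: feasible_def mem_Collect_eq regular_iff_pos) simp
    then show "\<exists>x\<in>feasible g h. M *v x \<le> x"
      using kleene_star_vector_sub_fixed * by blast
  qed
qed


section \<open>Expansion of matrix binomials\<close>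

text \<open>Tuples are sorted by their first exponent: if it is positive, the word starts with
  \<open>A\<close> and the exponent drops by one; if it is zero, the word starts with
  \<open>B\<close> and the head is dropped.\<close>

lemma exponent_tuples_rec:
  assumes "0 < k + m"
  shows "exponent_tuples k m =
    (if 0 < m then (\<lambda>is. Suc (hd is) # tl is) ` exponent_tuples k (m - 1) else {}) \<union>
    (if 0 < k then (#) 0 ` exponent_tuples (k - 1) m else {})" (is "_ = ?R")
proof (intro equalityI subsetI)
  fix js assume js: "js \<in> exponent_tuples k m"
  then obtain i is' where eq: "js = i # is'" "length is' = k" "i + sum_list is' = m"
    by (cases js) (auto simp: exponent_tuples_def)
  show "js \<in> ?R"
  proof (cases i)
    case 0
    then have "0 < k"
      using assms eq by (cases k) auto
    moreover have "js = 0 # is'" "is' \<in> exponent_tuples (k - 1) m"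
      using 0 eq \<open>0 < k\<close> by (simp_all add: exponent_tuples_def)
    ultimately show ?thesis
      unfolding Un_iff by (intro disjI2) (simp only: if_True image_eqI)
  next
    case (Suc i')
    then have "0 < m" "i' # is' \<in> exponent_tuples k (m - 1)"
      using eq by (auto simp: exponent_tuples_def)
    moreover have "js = (\<lambda>is. Suc (hd is) # tl is) (i' # is')"
      using Suc eq by simp
    ultimately show ?thesis
      unfolding Un_iff by (intro disjI1) (simp only: if_True image_eqI)
  qed
next
  fix js assume "js \<in> ?R"
  then show "js \<in> exponent_tuples k m"
  proof
    assume "js \<in> (if 0 < m then (\<lambda>is. Suc (hd is) # tl is) ` exponent_tuples k (m - 1) else {})"
    then obtain is' where "0 < m" "is' \<in> exponent_tuples k (m - 1)" "js = Suc (hd is') # tl is'"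
      by (simp split: if_split_asm) blast
    then show ?thesis
      by (cases is') (simp_all add: exponent_tuples_def)
  next
    assume "js \<in> (if 0 < k then (#) 0 ` exponent_tuples (k - 1) m else {})"
    then obtain is' where "0 < k" "is' \<in> exponent_tuples (k - 1) m" "js = 0 # is'"
      by (simp split: if_split_asm) blast
    then show ?thesis
      by (simp add: exponent_tuples_def)
  qed
qed

lemma mixed_mat_0_0: "mixed_mat A B 0 0 = mat 1"
proof -
  have "exponent_tuples 0 0 = {[0]}"
    by (auto simp: exponent_tuples_def length_Suc_conv)
  then show ?thesis
    by (simp add: mixed_mat_def word_mat_def)
qed

text \<open>A noncommutative Pascal rule: \<open>mixed_mat A B k m\<close> adds up all words with
  \<open>k\<close> letters \<open>B\<close> and \<open>m\<close> letters \<open>A\<close>, here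
  split by the leading letter.\<close>

lemma mixed_mat_rec:
  assumes "0 < k + m"
  shows "mixed_mat A B k m =
    (if 0 < m then A ** mixed_mat A B k (m - 1) else 0) +
    (if 0 < k then B ** mixed_mat A B (k - 1) m else 0)"
proof -
  let ?inc = "\<lambda>is. Suc (hd is) # tl is"
  let ?X = "if 0 < m then ?inc ` exponent_tuples k (m - 1) else {}"
  let ?Y = "if 0 < k then (#) 0 ` exponent_tuples (k - 1) m else {}"
  have X: "sum (word_mat A B) (?inc ` exponent_tuples k m') = A ** mixed_mat A B k m'" for m'
  proof -
    have "inj_on ?inc (exponent_tuples k m')"
    proof (rule inj_onI)
      fix xs ys
      assume "xs \<in> exponent_tuples k m'" "ys \<in> exponent_tuples k m'" "?inc xs = ?inc ys"
      then show "xs = ys"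
        by (cases xs; cases ys) (simp_all add: exponent_tuples_def)
    qed
    then have "sum (word_mat A B) (?inc ` exponent_tuples k m') =
        (\<Sum>is\<in>exponent_tuples k m'. word_mat A B (?inc is))"
      by (simp only: sum.reindex o_def)
    also have "\<dots> = (\<Sum>is\<in>exponent_tuples k m'. A ** word_mat A B is)"
      by (rule sum.cong) (simp_all add: word_mat_def matrix_mul_assoc)
    finally show ?thesis
      by (simp only: mixed_mat_def matrix_mult_sum_right[OF finite_exponent_tuples])
  qed
  have Y: "sum (word_mat A B) ((#) 0 ` exponent_tuples k' m) = B ** mixed_mat A B k' m" for k'
  proof -
    \<comment> \<open>The new head contributes the identity, and the old head moves into a block
      \<open>B ** mat_pow A i\<close>.\<close>
    have word: "word_mat A B (0 # is) = B ** word_mat A B is" if "is \<in> exponent_tuples k' m" for "is"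
      using that by (cases "is") (simp_all add: word_mat_def exponent_tuples_def matrix_mul_assoc)
    have "sum (word_mat A B) ((#) 0 ` exponent_tuples k' m) =
        (\<Sum>is\<in>exponent_tuples k' m. word_mat A B (0 # is))"
      by (subst sum.reindex) (simp_all add: o_def)
    also have "\<dots> = (\<Sum>is\<in>exponent_tuples k' m. B ** word_mat A B is)"
      by (rule sum.cong[OF refl word])
    finally show ?thesis
      by (simp only: mixed_mat_def matrix_mult_sum_right[OF finite_exponent_tuples])
  qed
  have "finite ?X" "finite ?Y"
    by (simp_all add: finite_exponent_tuples)
  moreover have "?X \<inter> ?Y = {}"
    by (auto simp: disjoint_iff image_iff)
  ultimately have "mixed_mat A B k m = sum (word_mat A B) ?X + sum (word_mat A B) ?Y"
    unfolding mixed_mat_def exponent_tuples_rec[OF assms] by (rule sum.union_disjoint)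
  moreover have "sum (word_mat A B) ?X = (if 0 < m then A ** mixed_mat A B k (m - 1) else 0)"
    by (cases "0 < m") (simp_all only: if_True if_False X sum.empty)
  moreover have "sum (word_mat A B) ?Y = (if 0 < k then B ** mixed_mat A B (k - 1) m else 0)"
    by (cases "0 < k") (simp_all only: if_True if_False Y sum.empty)
  ultimately show ?thesis
    by (simp only:)
qed

lemma mixed_mat_0_left: "mixed_mat A B 0 m = mat_pow A m"
  by (induction m) (simp_all add: mixed_mat_0_0 mixed_mat_rec)

lemma mixed_mat_0_right: "mixed_mat A B k 0 = mat_pow B k"
  by (induction k) (simp_all add: mixed_mat_0_0 mixed_mat_rec)

section \<open>Binomial expansion of scaled matrices\<close>

lemma matrix_mult_add_left: "(M + N) ** K = M ** K + N ** K"
  by (simp add: matrix_matrix_mult_def vec_eq_iff distrib_right sum.distrib)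

lemma smult_mat_mult_left: "smult_mat c M ** N = smult_mat c (M ** N)"
  by (simp add: smult_mat_def matrix_matrix_mult_def vec_eq_iff sum_distrib_left mult.assoc)

lemma smult_mat_mult_right:
  fixes c :: "'a::comm_semiring_1"
  shows "M ** smult_mat c N = smult_mat c (M ** N)"
  by (simp add: smult_mat_def matrix_matrix_mult_def vec_eq_iff sum_distrib_left mult.left_commute)

lemma smult_mat_smult_mat: "smult_mat c (smult_mat d M) = smult_mat (c * d) M"
  by (simp add: smult_mat_def vec_eq_iff mult.assoc)

lemma smult_mat_add: "smult_mat c (M + N) = smult_mat c M + smult_mat c N"
  by (simp add: smult_mat_def vec_eq_iff distrib_left)

lemma smult_mat_0_right: "smult_mat c 0 = 0"
  by (simp add: smult_mat_def vec_eq_iff)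

text \<open>A noncommutative binomial theorem: all words with equally many letters \<open>B\<close>
  carry the same scalar. The induction follows the leading-letter recurrence.\<close>

lemma mat_pow_smult_add:
  fixes A B :: "'a::comm_semiring_1 ^ 'n ^ 'n"
  shows "mat_pow (smult_mat x A + smult_mat y B) p =
    (\<Sum>k\<le>p. smult_mat (x ^ (p - k) * y ^ k) (mixed_mat A B k (p - k)))"
proof (induction p)
  case 0
  show ?case by (simp add: mixed_mat_0_0 smult_mat_def vec_eq_iff)
next
  case (Suc p)
  let ?F = "mixed_mat A B"
  let ?a = "\<lambda>k. smult_mat (x ^ (Suc p - k) * y ^ k) (A ** ?F k (p - k))"
  let ?b = "\<lambda>k. smult_mat (x ^ (p - k) * y ^ Suc k) (B ** ?F k (p - k))"
  have "smult_mat x A ** smult_mat (x ^ (p - k) * y ^ k) (?F k (p - k)) = ?a k" if "k \<le> p" for k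
    using that by (simp add: smult_mat_mult_left smult_mat_mult_right smult_mat_smult_mat
        Suc_diff_le mult_ac)
  moreover have "smult_mat y B ** smult_mat (x ^ (p - k) * y ^ k) (?F k (p - k)) = ?b k" for k
    by (simp add: smult_mat_mult_left smult_mat_mult_right smult_mat_smult_mat mult_ac)
  ultimately have "mat_pow (smult_mat x A + smult_mat y B) (Suc p) =
      (\<Sum>k\<le>p. ?a k) + (\<Sum>k\<le>p. ?b k)"
    by (simp add: Suc matrix_mult_sum_right matrix_mult_add_left sum.distrib)
  \<comment> \<open>Both sums are extended to \<open>k \<le> Suc p\<close>: the added
    \<open>A\<close> term at \<open>k = Suc p\<close> and, after an index shift, the added
    \<open>B\<close> term at \<open>k = 0\<close> are zero.\<close>
  also have "(\<Sum>k\<le>p. ?a k) =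
      (\<Sum>k\<le>Suc p. smult_mat (x ^ (Suc p - k) * y ^ k)
         (if 0 < Suc p - k then A ** ?F k (Suc p - k - 1) else 0))"
    by (auto simp: smult_mat_0_right intro!: sum.cong)
  also have "(\<Sum>k\<le>p. ?b k) =
      (\<Sum>k\<le>Suc p. smult_mat (x ^ (Suc p - k) * y ^ k)
         (if 0 < k then B ** ?F (k - 1) (Suc p - k) else 0))"
    by (subst sum.atMost_Suc_shift) (simp add: smult_mat_0_right)
  finally show ?case
    by (simp only: sum.distrib[symmetric] smult_mat_add[symmetric])
      (intro sum.cong refl arg_cong[where f = "smult_mat _"] mixed_mat_rec[symmetric], simp)
qed

lemma semifield_inverse_powers_le_one_iff:
  fixes a b c :: "'a::linordered_radicable_idempotent_semifield"
  assumes "0 < a" "0 < b"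
  shows "inverse a ^ m * inverse b ^ k * c \<le> 1 \<longleftrightarrow> c \<le> a ^ m * b ^ k"
proof -
  have "inverse (a ^ m) * (inverse (b ^ k) * c) \<le> 1 \<longleftrightarrow> c \<le> b ^ k * (a ^ m * 1)"
    by (simp only: semifield_inverse_mult_le_iff semifield_power_pos assms)
  then show ?thesis
    by (simp add: semifield_inverse_power assms mult_ac)
qed

text \<open>The trace and the form \<open>row_mat_col u M v\<close> are both linear in
  \<open>M\<close>, so \<open>\<phi>\<close> stands for either. It maps the expansion to a sum of
  scalars, which is bounded exactly when each term is.\<close>

lemma functional_mat_pow_le_one_iff:
  fixes A B :: "'a::linordered_radicable_idempotent_semifield ^ 'n ^ 'n"
  assumes "0 < \<alpha>" "0 < \<beta>"
    and add: "\<And>M N. \<phi> (M + N) = \<phi> M + \<phi> N" and zero: "\<phi> 0 = 0"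
    and smult: "\<And>c M. \<phi> (smult_mat c M) = c * \<phi> M"
  shows "\<phi> (mat_pow (smult_mat (inverse \<alpha>) A + smult_mat (inverse \<beta>) B) p) \<le> 1 \<longleftrightarrow>
    (\<forall>k\<le>p. \<phi> (mixed_mat A B k (p - k)) \<le> \<alpha> ^ (p - k) * \<beta> ^ k)"
proof -
  have "\<phi> (sum f S) = (\<Sum>k\<in>S. \<phi> (f k))" if "finite S" for f :: "nat \<Rightarrow> _" and S
    using that by induction (simp_all add: add zero)
  then show ?thesis
    by (simp add: mat_pow_smult_add semifield_sum_le_iff smult
        semifield_inverse_powers_le_one_iff assms(1,2) Ball_def)
qed

lemma trace_mat_pow_le_one_iff:
  fixes A B :: "'a::linordered_radicable_idempotent_semifield ^ 'n ^ 'n"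
  assumes "0 < \<alpha>" "0 < \<beta>"
  shows "trace (mat_pow (smult_mat (inverse \<alpha>) A + smult_mat (inverse \<beta>) B) p) \<le> 1 \<longleftrightarrow>
    (\<forall>k\<le>p. trace (mixed_mat A B k (p - k)) \<le> \<alpha> ^ (p - k) * \<beta> ^ k)"
  by (rule functional_mat_pow_le_one_iff[where \<phi> = trace, OF assms])
    (simp_all add: trace_def smult_mat_def sum.distrib sum_distrib_left)

lemma row_mat_col_mat_pow_le_one_iff:
  fixes A B :: "'a::linordered_radicable_idempotent_semifield ^ 'n ^ 'n"
  assumes "0 < \<alpha>" "0 < \<beta>"
  shows "row_mat_col u (mat_pow (smult_mat (inverse \<alpha>) A + smult_mat (inverse \<beta>) B) p) v \<le> 1 \<longleftrightarrow>
    (\<forall>k\<le>p. row_mat_col u (mixed_mat A B k (p - k)) v \<le> \<alpha> ^ (p - k) * \<beta> ^ k)"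
  by (rule functional_mat_pow_le_one_iff[where \<phi> = "\<lambda>M. row_mat_col u M v", OF assms])
    (simp_all add: row_mat_col_def scalar_product_def matrix_vector_mult_def smult_mat_def
      sum.distrib sum_distrib_left distrib_left distrib_right mult_ac)


section \<open>The thresholds as solvability conditions\<close>

lemma spectral_radius_le_iff:
  "spectral_radius (M :: 'a::linordered_radicable_idempotent_semifield ^ 'n ^ 'n) \<le> c \<longleftrightarrow>
    (\<forall>k\<in>{1..CARD('n)}. trace (mat_pow M k) \<le> c ^ k)"
  unfolding spectral_radius_def semifield_sum_le_iff[OF finite_atLeastAtMost]
  by (intro ball_cong refl root_le_iff) simp

lemma bound_scalar_le_iff:
  "bound_scalar (M :: 'a::linordered_radicable_idempotent_semifield ^ 'n ^ 'n) g h \<le> c \<longleftrightarrow>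
    (\<forall>k\<in>{1..CARD('n) - 1}. row_mat_col (conj_vec h) (mat_pow M k) g \<le> c ^ k)"
  unfolding bound_scalar_def semifield_sum_le_iff[OF finite_atLeastAtMost]
  by (intro ball_cong refl root_le_iff) simp

lemma G_fun_le_iff:
  fixes A B :: "'a::linordered_radicable_idempotent_semifield ^ 'n ^ 'n"
  assumes "0 < s"
  shows "G_fun A B g h s \<le> t \<longleftrightarrow>
    (\<forall>k\<in>{1..CARD('n) - 1}. \<forall>m\<in>{1..CARD('n) - k}. trace (mixed_mat A B k m) \<le> s ^ m * t ^ k) \<and>
    (\<forall>k\<in>{1..CARD('n) - 2}. \<forall>m\<in>{1..CARD('n) - k - 1}.
       row_mat_col (conj_vec h) (mixed_mat A B k m) g \<le> s ^ m * t ^ k)"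
  unfolding G_fun_def semifield_add_le_iff semifield_sum_le_iff[OF finite_atLeastAtMost]
  by (intro conj_cong ball_cong refl root_term_le_iff assms) simp_all

lemma G_fun_less_iff:
  fixes A B :: "'a::linordered_radicable_idempotent_semifield ^ 'n ^ 'n"
  assumes "0 < s" "0 < t"
  shows "G_fun A B g h s < t \<longleftrightarrow>
    (\<forall>k\<in>{1..CARD('n) - 1}. \<forall>m\<in>{1..CARD('n) - k}. trace (mixed_mat A B k m) < s ^ m * t ^ k) \<and>
    (\<forall>k\<in>{1..CARD('n) - 2}. \<forall>m\<in>{1..CARD('n) - k - 1}.
       row_mat_col (conj_vec h) (mixed_mat A B k m) g < s ^ m * t ^ k)"
  unfolding G_fun_def semifield_add_less_iff
    semifield_sum_less_iff[OF finite_atLeastAtMost assms(2)]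
  by (intro conj_cong ball_cong refl root_term_less_iff assms) simp_all

text \<open>Both sides unfold to the same family of bounds by \<open>s ^ m * t ^ k\<close>, solved
  once for \<open>s\<close> and once for \<open>t\<close>.\<close>

lemma H_fun_le_iff_G_fun_le:
  fixes A B :: "'a::linordered_radicable_idempotent_semifield ^ 'n ^ 'n"
  assumes "0 < s" "0 < t"
  shows "H_fun A B g h t \<le> s \<longleftrightarrow> G_fun A B g h s \<le> t"
  unfolding G_fun_le_iff[OF assms(1)] H_fun_def semifield_add_le_iff
    semifield_sum_le_iff[OF finite_atLeastAtMost] mult.commute[of "s ^ _"]
  by (intro conj_cong ball_cong refl root_term_le_iff assms) simp_all

text \<open>Together with the nonstrict version this makes \<open>G s = t\<close> equivalent to
  \<open>H t = s\<close> on positive scalars.\<close>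

lemma H_fun_less_iff_G_fun_less:
  fixes A B :: "'a::linordered_radicable_idempotent_semifield ^ 'n ^ 'n"
  assumes "0 < s" "0 < t"
  shows "H_fun A B g h t < s \<longleftrightarrow> G_fun A B g h s < t"
  unfolding G_fun_less_iff[OF assms] H_fun_def semifield_add_less_iff
    semifield_sum_less_iff[OF finite_atLeastAtMost assms(1)] mult.commute[of "s ^ _"]
  by (intro conj_cong ball_cong refl root_term_less_iff assms) simp_all

section \<open>Attainable pairs of objective bounds\<close>

lemma objectives_le_iff_sub_fixed:
  fixes A B :: "'a::linordered_radicable_idempotent_semifield ^ 'n ^ 'n"
  assumes "regular x" "0 < \<alpha>" "0 < \<beta>"
  shows "objective A x \<le> \<alpha> \<and> objective B x \<le> \<beta> \<longleftrightarrow>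
    (smult_mat (inverse \<alpha>) A + smult_mat (inverse \<beta>) B) *v x \<le> x"
proof -
  have "(smult_mat (inverse \<alpha>) A + smult_mat (inverse \<beta>) B) *v x \<le> x \<longleftrightarrow>
      (\<forall>i j. inverse \<alpha> * (A $ i $ j * x $ j) \<le> x $ i \<and> inverse \<beta> * (B $ i $ j * x $ j) \<le> x $ i)"
    by (simp add: less_eq_vec_def matrix_vector_le_iff smult_mat_def distrib_right
        semifield_add_le_iff mult.assoc)
  also have "\<dots> \<longleftrightarrow> (\<forall>i j. A $ i $ j * x $ j \<le> x $ i * \<alpha> \<and> B $ i $ j * x $ j \<le> x $ i * \<beta>)"
    by (simp add: semifield_inverse_mult_le_iff assms mult.commute[of "x $ _"])
  finally show ?thesis
    unfolding objective_def row_mat_col_conj_le_iff[OF assms(1)] matrix_vector_le_iff by blast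
qed

text \<open>The expansion yields one bound per pair \<open>(k, m)\<close>. The degree
  \<open>k + m\<close> reaches \<open>CARD('n)\<close> for traces but only
  \<open>CARD('n) - 1\<close> for the terms with \<open>h\<close> and \<open>g\<close>, which
  explains the differing index ranges of the thresholds.\<close>

lemma attainable_iff:
  fixes A B :: "'a::linordered_radicable_idempotent_semifield ^ 'n ^ 'n"
  assumes h: "regular h" and gh: "g \<le> h" and pos: "0 < \<alpha>" "0 < \<beta>"
  shows "(\<exists>x\<in>feasible g h. objective A x \<le> \<alpha> \<and> objective B x \<le> \<beta>) \<longleftrightarrow>
    spectral_radius A + bound_scalar A g h \<le> \<alpha> \<and>
    spectral_radius B + bound_scalar B g h \<le> \<beta> \<and> G_fun A B g h \<alpha> \<le> \<beta>"
proof -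
  let ?n = "CARD('n)"
  let ?tr = "\<lambda>k m. trace (mixed_mat A B k m) \<le> \<alpha> ^ m * \<beta> ^ k"
  let ?row = "\<lambda>k m. row_mat_col (conj_vec h) (mixed_mat A B k m) g \<le> \<alpha> ^ m * \<beta> ^ k"
  \<comment> \<open>This bound of degree zero occurs in no threshold; it is supplied by
    \<open>g \<le> h\<close>.\<close>
  have "?row 0 0"
    using gh by (simp add: mixed_mat_0_0 row_mat_col_conj_le_iff[OF h] less_eq_vec_def)
  have "(\<exists>x\<in>feasible g h. objective A x \<le> \<alpha> \<and> objective B x \<le> \<beta>) \<longleftrightarrow>
      (\<exists>x\<in>feasible g h. (smult_mat (inverse \<alpha>) A + smult_mat (inverse \<beta>) B) *v x \<le> x)"
    by (intro bex_cong refl objectives_le_iff_sub_fixed pos) (simp add: feasible_def)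
  also have "\<dots> \<longleftrightarrow> (\<forall>p\<in>{1..?n}. \<forall>k\<le>p. ?tr k (p - k)) \<and> (\<forall>p<?n. \<forall>k\<le>p. ?row k (p - k))"
    unfolding sub_fixed_feasible_iff[OF h] trace_mat_pow_le_one_iff[OF pos]
      row_mat_col_mat_pow_le_one_iff[OF pos] ..
  \<comment> \<open>The index triangle is cut into the axes \<open>k = 0\<close> and
    \<open>m = 0\<close>, which give the spectral radii, and the interior, which gives the trace
    part of \<open>G_fun\<close>.\<close>
  also have "(\<forall>p\<in>{1..?n}. \<forall>k\<le>p. ?tr k (p - k)) \<longleftrightarrow>
      (\<forall>m\<in>{1..?n}. ?tr 0 m) \<and> (\<forall>k\<in>{1..?n}. ?tr k 0) \<and>
      (\<forall>k\<in>{1..?n - 1}. \<forall>m\<in>{1..?n - k}. ?tr k m)" (is "?L \<longleftrightarrow> ?R")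
  proof
    assume L: ?L
    have all: "?tr k m" if "1 \<le> k + m" "k + m \<le> ?n" for k m
      using L[rule_format, of "k + m" k] that by simp
    show ?R by (intro conjI ballI all) auto
  next
    assume R: ?R
    have "?tr k m" if "1 \<le> k + m" "k + m \<le> ?n" for k m
      using R that by (cases "k = 0"; cases "m = 0") auto
    then show ?L by auto
  qed
  also have "(\<forall>p<?n. \<forall>k\<le>p. ?row k (p - k)) \<longleftrightarrow>
      (\<forall>m\<in>{1..?n - 1}. ?row 0 m) \<and> (\<forall>k\<in>{1..?n - 1}. ?row k 0) \<and>
      (\<forall>k\<in>{1..?n - 2}. \<forall>m\<in>{1..?n - k - 1}. ?row k m)" (is "?L \<longleftrightarrow> ?R")
  proof
    assume L: ?L
    have all: "?row k m" if "k + m < ?n" for k m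
      using L[rule_format, of "k + m" k] that by simp
    show ?R by (intro conjI ballI all) auto
  next
    assume R: ?R
    have "?row k m" if "k + m < ?n" for k m
      using R that \<open>?row 0 0\<close> by (cases "k = 0"; cases "m = 0") auto
    then show ?L by auto
  qed
  finally show ?thesis
    unfolding semifield_add_le_iff spectral_radius_le_iff bound_scalar_le_iff G_fun_le_iff[OF pos(1)]
    by (auto simp: mixed_mat_0_left mixed_mat_0_right)
qed

text \<open>A zero value would force every \<open>M $ i $ j * x $ j\<close> to vanish, hence
  \<open>M = 0\<close>. This makes the coordinates of front points invertible.\<close>

lemma objective_pos:
  fixes M :: "'a::linordered_radicable_idempotent_semifield ^ 'n ^ 'n"
  assumes "M \<noteq> 0" "regular x"
  shows "0 < objective M x"
proof (rule ccontr)
  assume "\<not> 0 < objective M x"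
  then have "objective M x \<le> 0"
    by simp
  then have "M $ i $ j * x $ j \<le> 0" for i j
    by (simp only: objective_def row_mat_col_conj_le_iff[OF assms(2)] matrix_vector_le_iff mult_zero_right)
  then have "\<not> 0 < M $ i $ j" for i j
    using semifield_mult_pos[OF _ regular_pos[OF assms(2)]] by (simp only: not_le[symmetric]) blast
  then have "M = 0"
    by (simp add: vec_eq_iff)
  then show False
    using assms(1) by simp
qed


section \<open>Pareto front and Pareto-optimal solutions\<close>

text \<open>The front is the set of minimal points of the upward closed region of attainable bounds,
  which is the region that the thresholds describe. Restricting to positive bounds is harmless
  because objective values are positive.\<close>

lemma pareto_front_iff:
  fixes A B :: "'a::linordered_radicable_idempotent_semifield ^ 'n ^ 'n"
    and g h :: "'a ^ 'n"
  assumes "A \<noteq> 0" "B \<noteq> 0"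
  defines "attainable \<equiv> \<lambda>\<alpha> \<beta>. \<exists>x\<in>feasible g h. objective A x \<le> \<alpha> \<and> objective B x \<le> \<beta>"
  shows "(\<alpha>, \<beta>) \<in> pareto_front A B g h \<longleftrightarrow> 0 < \<alpha> \<and> 0 < \<beta> \<and> attainable \<alpha> \<beta> \<and>
    (\<forall>\<alpha>' \<beta>'. 0 < \<alpha>' \<longrightarrow> 0 < \<beta>' \<longrightarrow> attainable \<alpha>' \<beta>' \<longrightarrow> \<alpha>' \<le> \<alpha> \<longrightarrow> \<beta>' \<le> \<beta> \<longrightarrow>
       \<alpha>' = \<alpha> \<and> \<beta>' = \<beta>)" (is "_ \<longleftrightarrow> ?R")
proof
  have pos: "0 < objective A x" "0 < objective B x" if "x \<in> feasible g h" for x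
    using that assms(1,2) by (simp_all add: objective_pos feasible_def)
  {
    assume "(\<alpha>, \<beta>) \<in> pareto_front A B g h"
    then obtain x where x: "pareto_optimal (feasible g h) (objective A) (objective B) x"
      and eq: "\<alpha> = objective A x" "\<beta> = objective B x"
      by (auto simp: pareto_front_def pareto_solutions_def)
    have S: "x \<in> feasible g h"
      using x by (simp add: pareto_optimal_def)
    have "\<alpha>' = \<alpha> \<and> \<beta>' = \<beta>"
      if att: "attainable \<alpha>' \<beta>'" and le: "\<alpha>' \<le> \<alpha>" "\<beta>' \<le> \<beta>" for \<alpha>' \<beta>'
    proof -
      obtain y where y: "y \<in> feasible g h" "objective A y \<le> \<alpha>'" "objective B y \<le> \<beta>'"
        using att unfolding attainable_def by auto
      have "\<not> (objective A y < \<alpha> \<and> objective B y \<le> \<beta>)" "\<not> (objective A y \<le> \<alpha> \<and> objective B y < \<beta>)"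
        using x y(1) unfolding pareto_optimal_def eq by blast+
      then show ?thesis
        using y(2,3) le by (meson antisym leI order_trans)
    qed
    moreover have "attainable \<alpha> \<beta>"
      unfolding attainable_def eq using S by blast
    ultimately show ?R
      using pos[OF S] eq by blast
  }
  assume R: ?R
  then obtain x where x: "x \<in> feasible g h" "objective A x \<le> \<alpha>" "objective B x \<le> \<beta>"
    unfolding attainable_def by blast
  \<comment> \<open>The objective values of \<open>y\<close> are themselves attainable bounds, so
    minimality forces equality.\<close>
  have attains: "objective A y = \<alpha> \<and> objective B y = \<beta>"
    if "y \<in> feasible g h" "objective A y \<le> \<alpha>" "objective B y \<le> \<beta>" for y
  proof -
    have "attainable (objective A y) (objective B y)"
      unfolding attainable_def using that(1) by blast
    then show ?thesis
      using R pos[OF that(1)] that(2,3) by blast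
  qed
  have "pareto_optimal (feasible g h) (objective A) (objective B) x"
    unfolding pareto_optimal_def
  proof (intro conjI notI)
    assume "\<exists>y\<in>feasible g h. objective A y < objective A x \<and> objective B y \<le> objective B x \<or>
      objective A y \<le> objective A x \<and> objective B y < objective B x"
    then obtain y where y: "y \<in> feasible g h" "objective A y \<le> objective A x"
      "objective B y \<le> objective B x"
      "objective A y < objective A x \<or> objective B y < objective B x"
      using less_imp_le by blast
    then show False
      using attains[OF y(1)] attains[OF x] by simp
  qed (rule x)
  then show "(\<alpha>, \<beta>) \<in> pareto_front A B g h"
    using attains[OF x] by (force simp: pareto_front_def pareto_solutions_def)
qed

text \<open>A feasible vector bounded by a front point cannot be strictly better in either
  objective, so it has the same values. The inequalities are the form that the Kleene star
  handles.\<close>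

lemma pareto_solutions_iff:
  fixes A B :: "'a::linordered_radicable_idempotent_semifield ^ 'n ^ 'n"
  shows "x \<in> pareto_solutions A B g h \<longleftrightarrow>
    (\<exists>\<alpha> \<beta>. (\<alpha>, \<beta>) \<in> pareto_front A B g h \<and>
       x \<in> feasible g h \<and> objective A x \<le> \<alpha> \<and> objective B x \<le> \<beta>)" (is "_ \<longleftrightarrow> ?R")
proof
  assume "x \<in> pareto_solutions A B g h"
  then show ?R
    by (intro exI[of _ "objective A x"] exI[of _ "objective B x"])
      (simp add: pareto_front_def pareto_solutions_def pareto_optimal_def)
next
  assume ?R
  then obtain y where y: "pareto_optimal (feasible g h) (objective A) (objective B) y"
    and x: "x \<in> feasible g h" "objective A x \<le> objective A y" "objective B x \<le> objective B y"
    by (auto simp: pareto_front_def pareto_solutions_def)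
  have "\<not> objective A x < objective A y" "\<not> objective B x < objective B y"
    using x y unfolding pareto_optimal_def by blast+
  then have "objective A x = objective A y" "objective B x = objective B y"
    using x by auto
  then show "x \<in> pareto_solutions A B g h"
    using x(1) y by (simp add: pareto_solutions_def pareto_optimal_def)
qed

text \<open>Forwards, \<open>u = x\<close> works. Backwards, attainability supplies the trace
  condition under which \<open>S *v u\<close> is a solution. Regularity stays a separate condition
  because \<open>u\<close>, and with it \<open>S *v u\<close>, may have zero components.\<close>

lemma kleene_star_parametrization:
  fixes A B :: "'a::linordered_radicable_idempotent_semifield ^ 'n ^ 'n"
  assumes h: "regular h" and pos: "0 < \<alpha>" "0 < \<beta>"
    and att: "\<exists>y\<in>feasible g h. objective A y \<le> \<alpha> \<and> objective B y \<le> \<beta>"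
  defines "S \<equiv> kleene_star (smult_mat (inverse \<alpha>) A + smult_mat (inverse \<beta>) B)"
  shows "x \<in> feasible g h \<and> objective A x \<le> \<alpha> \<and> objective B x \<le> \<beta> \<longleftrightarrow>
    regular x \<and> (\<exists>u. x = S *v u \<and> g \<le> u \<and> u \<le> conj_vec (conj_vec h v* S))"
proof -
  define C where "C = smult_mat (inverse \<alpha>) A + smult_mat (inverse \<beta>) B"
  have S: "S = kleene_star C"
    by (simp add: S_def C_def)
  have sub: "objective A y \<le> \<alpha> \<and> objective B y \<le> \<beta> \<longleftrightarrow> C *v y \<le> y" if "regular y" for y
    unfolding C_def by (rule objectives_le_iff_sub_fixed[OF that pos])
  have bound: "u \<le> conj_vec (conj_vec h v* S) \<longleftrightarrow> S *v u \<le> h" for u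
    unfolding S by (rule le_conj_kleene_star_iff[OF h])
  have "\<exists>y\<in>feasible g h. C *v y \<le> y"
    using att sub by (auto simp: feasible_def)
  then have tr: "\<forall>k\<in>{1..CARD('n)}. trace (mat_pow C k) \<le> 1"
    unfolding sub_fixed_feasible_iff[OF h] by blast
  show ?thesis
    unfolding bound
  proof (intro iffI conjI)
    assume *: "x \<in> feasible g h \<and> objective A x \<le> \<alpha> \<and> objective B x \<le> \<beta>"
    then show "regular x"
      by (simp add: feasible_def)
    then have "S *v x = x"
      unfolding S using * sub by (intro kleene_star_vector_fixed) blast
    then show "\<exists>u. x = S *v u \<and> g \<le> u \<and> S *v u \<le> h"
      using * by (intro exI[of _ x]) (simp add: feasible_def)
  next
    assume "regular x \<and> (\<exists>u. x = S *v u \<and> g \<le> u \<and> S *v u \<le> h)"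
    then obtain u where x: "regular x" "x = S *v u" "g \<le> u" "x \<le> h"
      by blast
    have "g \<le> x"
      using x(3) kleene_star_vector_ge[of u C] unfolding x(2) S by (rule order_trans)
    then show "x \<in> feasible g h"
      using x by (simp add: feasible_def)
    have "C *v x \<le> x"
      unfolding x(2) S by (rule kleene_star_vector_sub_fixed[OF tr])
    then show "objective A x \<le> \<alpha>" "objective B x \<le> \<beta>"
      using sub[OF x(1)] by blast+
  qed
qed

text \<open>Front points have positive coordinates, whereas \<open>lam + gam\<close> or
  \<open>mu + del\<close> can be \<open>0\<close>, for instance for a nilpotent matrix and
  \<open>g = 0\<close>. The positivity conditions exclude such unattained limits and arguments
  \<open>0\<close> of \<open>G\<close> and \<open>H\<close>.\<close>

theorem theorem4:
  fixes A B :: "'a::linordered_radicable_idempotent_semifield ^ 'n ^ 'n"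
    and g h :: "'a ^ 'n"
    and lam mu gam del :: 'a
    and G H :: "'a \<Rightarrow> 'a"
  assumes "A \<noteq> 0" and "B \<noteq> 0"
    and "regular h" and "g \<le> h"
    and "lam = spectral_radius A" and "mu = spectral_radius B"
    and "gam = bound_scalar A g h" and "del = bound_scalar B g h"
    and "G = G_fun A B g h" and "H = H_fun A B g h"
  shows
    "(0 < lam + gam \<and> 0 < mu + del \<and> H (mu + del) \<le> lam + gam \<longrightarrow>
        pareto_front A B g h = {(lam + gam, mu + del)}) \<and>
     (0 < mu + del \<and> H (mu + del) > lam + gam \<longrightarrow>
        pareto_front A B g h =
          {(\<alpha>, \<beta>). 0 < \<alpha> \<and> lam + gam \<le> \<alpha> \<and> \<alpha> \<le> H (mu + del) \<and> \<beta> = G \<alpha>}) \<and>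
     pareto_solutions A B g h =
       {x. regular x \<and> (\<exists>\<alpha> \<beta> u. (\<alpha>, \<beta>) \<in> pareto_front A B g h \<and>
          (let S = kleene_star (smult_mat (inverse \<alpha>) A + smult_mat (inverse \<beta>) B)
           in x = S *v u \<and> g \<le> u \<and> u \<le> conj_vec (conj_vec h v* S)))}"
proof -
  define a where "a = lam + gam"
  define b where "b = mu + del"
  define E where "E = (\<lambda>\<alpha> \<beta>. \<exists>x\<in>feasible g h. objective A x \<le> \<alpha> \<and> objective B x \<le> \<beta>)"
  have E: "E \<alpha> \<beta> \<longleftrightarrow> a \<le> \<alpha> \<and> b \<le> \<beta> \<and> G \<alpha> \<le> \<beta>" if "0 < \<alpha>" "0 < \<beta>" for \<alpha> \<beta>
    unfolding E_def a_def b_def assms(5-9) by (rule attainable_iff[OF assms(3,4) that])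
  have front: "(\<alpha>, \<beta>) \<in> pareto_front A B g h \<longleftrightarrow> 0 < \<alpha> \<and> 0 < \<beta> \<and> E \<alpha> \<beta> \<and>
      (\<forall>\<alpha>' \<beta>'. 0 < \<alpha>' \<longrightarrow> 0 < \<beta>' \<longrightarrow> E \<alpha>' \<beta>' \<longrightarrow> \<alpha>' \<le> \<alpha> \<longrightarrow> \<beta>' \<le> \<beta> \<longrightarrow> \<alpha>' = \<alpha> \<and> \<beta>' = \<beta>)" for \<alpha> \<beta>
    unfolding E_def by (rule pareto_front_iff[OF assms(1,2)])
  have GH_le: "H \<beta> \<le> \<alpha> \<longleftrightarrow> G \<alpha> \<le> \<beta>" if "0 < \<alpha>" "0 < \<beta>" for \<alpha> \<beta>
    unfolding assms(9,10) by (rule H_fun_le_iff_G_fun_le[OF that])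
  have GH_less: "H \<beta> < \<alpha> \<longleftrightarrow> G \<alpha> < \<beta>" if "0 < \<alpha>" "0 < \<beta>" for \<alpha> \<beta>
    unfolding assms(9,10) by (rule H_fun_less_iff_G_fun_less[OF that])
  have "pareto_front A B g h = {(a, b)}" if "0 < a" "0 < b" "H b \<le> a"
  proof (rule set_eqI, clarify)
    fix \<alpha> \<beta>
    \<comment> \<open>The corner itself is attainable, hence it is the least attainable
      point.\<close>
    have Eab: "E a b"
      using that GH_le[OF that(1,2)] by (simp add: E)
    show "(\<alpha>, \<beta>) \<in> pareto_front A B g h \<longleftrightarrow> (\<alpha>, \<beta>) \<in> {(a, b)}"
    proof
      assume "(\<alpha>, \<beta>) \<in> pareto_front A B g h"
      then have "0 < \<alpha>" "0 < \<beta>" "E \<alpha> \<beta>" and "a \<le> \<alpha> \<Longrightarrow> b \<le> \<beta> \<Longrightarrow> a = \<alpha> \<and> b = \<beta>"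
        unfolding front using that(1,2) Eab by blast+
      then show "(\<alpha>, \<beta>) \<in> {(a, b)}"
        by (simp add: E)
    next
      assume "(\<alpha>, \<beta>) \<in> {(a, b)}"
      then show "(\<alpha>, \<beta>) \<in> pareto_front A B g h"
        unfolding front using that(1,2) Eab by (auto simp: E intro: antisym)
    qed
  qed
  moreover have "pareto_front A B g h = {(\<alpha>, \<beta>). 0 < \<alpha> \<and> a \<le> \<alpha> \<and> \<alpha> \<le> H b \<and> \<beta> = G \<alpha>}"
    if b: "0 < b" and H: "a < H b"
  proof (intro set_eqI iffI; clarify)
    fix \<alpha> \<beta> assume "(\<alpha>, \<beta>) \<in> pareto_front A B g h"
    then have pos: "0 < \<alpha>" "0 < \<beta>" and "E \<alpha> \<beta>"
      and min: "\<And>\<alpha>' \<beta>'. 0 < \<alpha>' \<Longrightarrow> 0 < \<beta>' \<Longrightarrow> E \<alpha>' \<beta>' \<Longrightarrow> \<alpha>' \<le> \<alpha> \<Longrightarrow> \<beta>' \<le> \<beta> \<Longrightarrow> \<alpha>' = \<alpha> \<and> \<beta>' = \<beta>"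
      unfolding front by blast+
    then have att: "a \<le> \<alpha>" "b \<le> \<beta>" "G \<alpha> \<le> \<beta>"
      by (simp_all add: E)
    have \<alpha>: "\<alpha> \<le> H b"
    proof (rule ccontr)
      assume "\<not> \<alpha> \<le> H b"
      then have less: "H b < \<alpha>" by simp
      \<comment> \<open>If \<open>\<alpha>\<close> exceeded \<open>H b\<close>, the attainable point
        \<open>(H b, b)\<close> would contradict minimality.\<close>
      have "0 < H b"
        using zero_le H by (rule le_less_trans)
      moreover from this have "E (H b) b"
        using H GH_le[of "H b" b] b by (simp add: E)
      ultimately have "H b = \<alpha>"
        by (rule min[THEN conjunct1, OF _ b _ less_imp_le[OF less] att(2)])
      then show False
        using less by simp
    qed
    \<comment> \<open>Now \<open>(\<alpha>, G \<alpha>)\<close> satisfies all thresholds and lies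
      below \<open>(\<alpha>, \<beta>)\<close>, so the two coincide.\<close>
    then have "b \<le> G \<alpha>"
      using GH_less[OF pos(1) b] by (simp add: not_less[symmetric])
    moreover from this have "0 < G \<alpha>"
      using b by (rule less_le_trans[rotated])
    ultimately have "G \<alpha> = \<beta>"
      using min[of \<alpha> "G \<alpha>"] pos(1) att by (simp add: E)
    then show "0 < \<alpha> \<and> a \<le> \<alpha> \<and> \<alpha> \<le> H b \<and> \<beta> = G \<alpha>"
      using pos att \<alpha> by simp
  next
    fix \<alpha> assume \<alpha>: "0 < \<alpha>" "a \<le> \<alpha>" "\<alpha> \<le> H b"
    then have bG: "b \<le> G \<alpha>"
      using GH_less[OF \<alpha>(1) b] by (simp add: not_less[symmetric])
    with b have G: "0 < G \<alpha>"
      by (rule less_le_trans)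
    have "\<alpha>' = \<alpha> \<and> \<beta>' = G \<alpha>"
      if "0 < \<alpha>'" "0 < \<beta>'" "E \<alpha>' \<beta>'" "\<alpha>' \<le> \<alpha>" "\<beta>' \<le> G \<alpha>" for \<alpha>' \<beta>'
    proof -
      have le: "G \<alpha>' \<le> \<beta>'"
        using that by (simp add: E)
      \<comment> \<open>The nonstrict duality gives \<open>H (G \<alpha>) \<le> \<alpha>'\<close>,
        the strict one \<open>\<alpha> \<le> H (G \<alpha>)\<close>; so \<open>\<alpha>'\<close>
        cannot lie below \<open>\<alpha>\<close>.\<close>
      then have "H (G \<alpha>) \<le> \<alpha>'"
        unfolding GH_le[OF that(1) G] using that(5) by (rule order_trans)
      moreover have "\<not> H (G \<alpha>) < \<alpha>"
        using GH_less[OF \<alpha>(1) G] by simp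
      ultimately have "\<alpha>' = \<alpha>"
        using that(4) by auto
      then show ?thesis
        using le that(5) by simp
    qed
    then show "(\<alpha>, G \<alpha>) \<in> pareto_front A B g h"
      unfolding front using \<alpha> G bG by (simp add: E)
  qed
  moreover have "x \<in> pareto_solutions A B g h \<longleftrightarrow>
      regular x \<and> (\<exists>\<alpha> \<beta> u. (\<alpha>, \<beta>) \<in> pareto_front A B g h \<and>
        (let S = kleene_star (smult_mat (inverse \<alpha>) A + smult_mat (inverse \<beta>) B)
         in x = S *v u \<and> g \<le> u \<and> u \<le> conj_vec (conj_vec h v* S)))" for x
  proof -
    \<comment> \<open>Membership in the front supplies the positivity and attainability that the
      parametrization requires.\<close>
    have "(\<alpha>, \<beta>) \<in> pareto_front A B g h \<and>
        x \<in> feasible g h \<and> objective A x \<le> \<alpha> \<and> objective B x \<le> \<beta> \<longleftrightarrow>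
      (\<alpha>, \<beta>) \<in> pareto_front A B g h \<and> regular x \<and>
        (\<exists>u. let S = kleene_star (smult_mat (inverse \<alpha>) A + smult_mat (inverse \<beta>) B)
         in x = S *v u \<and> g \<le> u \<and> u \<le> conj_vec (conj_vec h v* S))" for \<alpha> \<beta>
      unfolding Let_def
      by (intro conj_cong refl kleene_star_parametrization[OF assms(3)])
        (simp_all only: front E_def)
    then show ?thesis
      unfolding pareto_solutions_iff by blast
  qed
  ultimately show ?thesis
    unfolding a_def[symmetric] b_def[symmetric] by (intro conjI impI set_eqI) simp_all
qed

end
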